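(* Let $n_1\geq n_2\geq n_3\ge 2$ be integers and $N = n_1 + n_2 + n_3$. Then \[ \mu_{\rm t}(K_{n_1}\,\square\, K_{n_2}\,\square\, K_{n_3}) = \begin{cases} N - 4, & n_3 = 2, \\ N - 5, & n_3 = 3, \\ N - 6, & n_3\ge 4. \end{cases} \]
   Context: For a connected graph $G$ and $X\subseteq V(G)$, two vertices $x,y$ are $X$-visible if there is a shortest $x,y$-path none of whose internal vertices lies in $X$. $X$ is a total mutual-visibility set if every two vertices of $V(G)$ are $X$-visible. $\mu_{\rm t}(G)$ is the maximum cardinality of a total mutual-visibility set of $G$. $G\,\square\, H$ denotes the Cartesian product of graphs: vertex set $V(G)\times V(H)$, with $(g,h)\sim(g',h')$ iff either $gg'\in E(G)$ and $h=h'$, or $g=g'$ and $hh'\in E(H)$. $K_n$ is the complete graph on $n$ vertices. *)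

theory Defs
  imports "Graph_Theory.Graph_Theory"
begin

text \<open>
  Undirected simple graphs are represented as in \<^locale>\<open>pair_graph\<close>: finite, loop-free digraphs with
  a symmetric arc relation. Paths are the vertex lists of \<^const>\<open>vpath\<close>.
\<close>

definition vpath_from_to :: "'a pair_pre_digraph \<Rightarrow> 'a \<Rightarrow> 'a list \<Rightarrow> 'a \<Rightarrow> bool" where
  "vpath_from_to G x p y \<longleftrightarrow> vpath p (with_proj G) \<and> hd p = x \<and> last p = y"

definition shortest_vpath :: "'a pair_pre_digraph \<Rightarrow> 'a \<Rightarrow> 'a list \<Rightarrow> 'a \<Rightarrow> bool" where
  "shortest_vpath G x p y \<longleftrightarrow>
     vpath_from_to G x p y \<and> (\<forall>q. vpath_from_to G x q y \<longrightarrow> vwalk_length p \<le> vwalk_length q)"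

text \<open>Vertices on a path are distinct, so the internal ones are those different from both ends.\<close>

definition visible :: "'a pair_pre_digraph \<Rightarrow> 'a set \<Rightarrow> 'a \<Rightarrow> 'a \<Rightarrow> bool" where
  "visible G X x y \<longleftrightarrow> (\<exists>p. shortest_vpath G x p y \<and> (set p - {x, y}) \<inter> X = {})"

definition total_mutual_visibility_set :: "'a pair_pre_digraph \<Rightarrow> 'a set \<Rightarrow> bool" where
  "total_mutual_visibility_set G X \<longleftrightarrow>
     X \<subseteq> pverts G \<and> (\<forall>x\<in>pverts G. \<forall>y\<in>pverts G. visible G X x y)"

text \<open>
  The maximum is meaningful when \<open>G\<close> is finite and connected: the collection is then finite, and it
  contains the empty set.
\<close>

definition mu_t :: "'a pair_pre_digraph \<Rightarrow> nat" (\<open>\<mu>\<^sub>t\<close>) where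
  "\<mu>\<^sub>t G = Max {card X | X. total_mutual_visibility_set G X}"

definition cart_prod ::
    "'a pair_pre_digraph \<Rightarrow> 'b pair_pre_digraph \<Rightarrow> ('a \<times> 'b) pair_pre_digraph" (infixl \<open>\<box>\<close> 70) where
  "G \<box> H = \<lparr> pverts = pverts G \<times> pverts H,
     parcs = {((g, h), (g', h')) | g h g' h'.
       (g, g') \<in> parcs G \<and> h = h' \<and> h \<in> pverts H \<or>
       g = g' \<and> g \<in> pverts G \<and> (h, h') \<in> parcs H} \<rparr>"

lemma pair_graph_cart_prod:
  assumes "pair_graph G" "pair_graph H"
  shows "pair_graph (G \<box> H)"
proof -
  interpret G: pair_graph G by fact
  interpret H: pair_graph H by fact
  have sub: "parcs (G \<box> H) \<subseteq> pverts (G \<box> H) \<times> pverts (G \<box> H)"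
    using G.in_arcsD1 G.in_arcsD2 H.in_arcsD1 H.in_arcsD2 by (auto simp: cart_prod_def)
  have fin: "finite (pverts (G \<box> H))"
    using G.pair_finite_verts H.pair_finite_verts by (simp add: cart_prod_def)
  have "sym (parcs G)" "sym (parcs H)"
    using G.pair_sym_arcs H.pair_sym_arcs by (simp_all add: symmetric_def)
  then have "sym (parcs (G \<box> H))"
    unfolding sym_def cart_prod_def by auto
  moreover have "fst e \<noteq> snd e" if "e \<in> parcs (G \<box> H)" for e
    using that G.pair_no_loops H.pair_no_loops by (fastforce simp: cart_prod_def)
  moreover have "finite (parcs (G \<box> H))"
    using sub fin by (meson finite_SigmaI finite_subset)
  ultimately show ?thesis
    using sub fin by unfold_locales (auto simp: symmetric_def)
qed

end

theory Submission
  imports Defs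
begin

text \<open>
  In \<open>K\<^sub>n\<^sub>1 \<box> K\<^sub>n\<^sub>2 \<box> K\<^sub>n\<^sub>3\<close> the graph distance is the Hamming distance. If two vertices of \<open>X\<close> are at
  distance exactly two, the other two corners of the square they span do not see each other.
  Conversely, if this never happens then every two vertices see each other: between antipodal corners
  of a cube there are six shortest paths, and \<open>X\<close> contains at most one of the three neighbours of
  either end, so it blocks at most four of them. Hence total mutual-visibility sets are exactly the
  sets without two points at distance two. On such a set being at distance at most one is an
  equivalence relation whose classes lie on lines and have pairwise disjoint projections to each
  coordinate. A class of size \<open>s\<close> uses up \<open>s + 2\<close> coordinate values, so \<open>k\<close> classes contain at most
  \<open>N - 2k\<close> points; one or two classes contain at most \<open>n\<^sub>1 + n\<^sub>2 - 2\<close> points.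
\<close>

section \<open>Hamming distance on triples\<close>

definition hdist :: "('a \<times> 'b) \<times> 'c \<Rightarrow> ('a \<times> 'b) \<times> 'c \<Rightarrow> nat" where
  "hdist x y = of_bool (fst (fst x) \<noteq> fst (fst y)) + of_bool (snd (fst x) \<noteq> snd (fst y))
     + of_bool (snd x \<noteq> snd y)"

lemma hdist_simps [simp]:
  "hdist ((a, b), c) ((a', b'), c') = of_bool (a \<noteq> a') + of_bool (b \<noteq> b') + of_bool (c \<noteq> c')"
  by (simp add: hdist_def)

lemma hdist_self [simp]: "hdist x x = 0"
  by (simp add: hdist_def)

lemma hdist_commute: "hdist x y = hdist y x"
  by (auto simp: hdist_def)

lemma hdist_triangle: "hdist x z \<le> hdist x y + hdist y z"
  by (auto simp: hdist_def)

lemma hdist_le_3: "hdist x y \<le> 3"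
  by (auto simp: hdist_def)

lemma hdist_0_iff [simp]: "hdist x y = 0 \<longleftrightarrow> x = y"
  by (auto simp: hdist_def prod_eq_iff)

section \<open>Visibility in Hamming graphs\<close>

locale hamming_graph =
  fixes G :: "(('a \<times> 'b) \<times> 'c) pair_pre_digraph" and A :: "'a set" and B :: "'b set" and C :: "'c set"
  assumes pverts_eq: "pverts G = (A \<times> B) \<times> C"
    and parcs_eq: "parcs G = {(x, y). x \<in> pverts G \<and> y \<in> pverts G \<and> hdist x y = 1}"
begin

text \<open>Every arc changes exactly one coordinate, so the triangle inequality accumulates along
  the walk. This lower bound certifies that a path is shortest.\<close>

lemma hdist_le_vwalk_length:
  assumes "vwalk p (with_proj G)"
  shows "hdist (hd p) (last p) \<le> vwalk_length p"
  using assms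
proof (induction p rule: vwalk_arcs.induct)
  case (3 x y xs)
  have "hdist x y = 1" "vwalk (y # xs) (with_proj G)"
    using "3.prems" by (auto simp: vwalk_def parcs_eq)
  with "3.IH" have "hdist y (last (y # xs)) \<le> length xs" by simp
  with hdist_triangle[of x "last (y # xs)" y] \<open>hdist x y = 1\<close> show ?case by simp
qed (auto simp: vwalk_def)

text \<open>No walk is shorter than the Hamming distance of its ends, so any path attaining it is
  shortest. The \<open>Suc\<close> arises because \<open>length\<close> counts vertices, one more
  than arcs.\<close>

lemma visibleI:
  assumes "vpath p (with_proj G)" "hd p = x" "last p = y" "length p = Suc (hdist x y)"
    and "(set p - {x, y}) \<inter> X = {}"
  shows "visible G X x y"
proof -
  have "hdist x y \<le> vwalk_length q" if "vpath_from_to G x q y" for q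
    using that hdist_le_vwalk_length[of q] by (auto simp: vpath_from_to_def vpath_def)
  with assms have "shortest_vpath G x p y"
    by (simp add: shortest_vpath_def vpath_from_to_def)
  with assms(5) show ?thesis unfolding visible_def by blast
qed

lemma visible_of_hdist_le_1:
  assumes "x \<in> pverts G" "y \<in> pverts G" "hdist x y \<le> 1"
  shows "visible G X x y"
proof (cases "x = y")
  case True
  with assms show ?thesis by (intro visibleI[of "[x]"]) (auto simp: vpath_def vwalk_def)
next
  case False
  then have "hdist x y = 1" using assms(3) by (metis hdist_0_iff le_neq_implies_less less_one)
  with assms False show ?thesis
    by (intro visibleI[of "[x, y]"]) (auto simp: vpath_def vwalk_def parcs_eq)
qed

lemma visible_via1:
  assumes "x \<in> pverts G" "y \<in> pverts G" "u \<in> pverts G" "u \<notin> X"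
    and "hdist x u = 1" "hdist u y = 1" "hdist x y = 2"
  shows "visible G X x y"
  using assms by (intro visibleI[of "[x, u, y]"]) (auto simp: vpath_def vwalk_def parcs_eq)

lemma visible_via2:
  assumes "x \<in> pverts G" "y \<in> pverts G" "u \<in> pverts G" "v \<in> pverts G" "u \<notin> X" "v \<notin> X"
    and "hdist x u = 1" "hdist u v = 1" "hdist v y = 1" "hdist x y = 3"
  shows "visible G X x y"
proof -
  \<comment> \<open>Needed for the vertices of the path to be distinct: either equality would put
    \<open>x\<close> and \<open>y\<close> at distance 1 instead of 3.\<close>
  have "x \<noteq> v" "u \<noteq> y"
    using assms hdist_triangle[of x y u] hdist_triangle[of u y v] by (auto simp: hdist_commute)
  with assms show ?thesis
    by (intro visibleI[of "[x, u, v, y]"]) (auto simp: vpath_def vwalk_def parcs_eq)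
qed

text \<open>The vertex \<open>u\<close>, which may lie in \<open>X\<close>, only shows that a path
  with three vertices exists. A shortest path then has exactly three, and its middle vertex is the
  required \<open>m\<close>.\<close>

lemma visible_hdist_2_obtains_midpoint:
  assumes "visible G X x y" "u \<in> pverts G" "x \<in> pverts G" "y \<in> pverts G"
    and "hdist x u = 1" "hdist u y = 1" "hdist x y = 2"
  obtains m where "m \<notin> X" "hdist x m = 1" "hdist m y = 1" "m \<in> pverts G"
proof -
  obtain p where p: "vpath p (with_proj G)" "hd p = x" "last p = y"
    and X: "(set p - {x, y}) \<inter> X = {}"
    and le: "\<And>q. vpath_from_to G x q y \<Longrightarrow> vwalk_length p \<le> vwalk_length q"
    using assms(1) unfolding visible_def shortest_vpath_def vpath_from_to_def by auto
  have "vpath_from_to G x [x, u, y] y"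
    using assms by (auto simp: vpath_from_to_def vpath_def vwalk_def parcs_eq)
  from le[OF this] have "length p \<le> 3" by simp
  moreover have "length p \<ge> 3"
    using hdist_le_vwalk_length[of p] p assms(7) by (auto simp: vpath_def)
  ultimately have "length p = 3" by simp
  then obtain x' m y' where "p = [x', m, y']"
    by (auto simp: numeral_3_eq_3 length_Suc_conv)
  with p X show thesis
    by (intro that[of m]) (auto simp: vpath_def vwalk_def parcs_eq)
qed

theorem total_mutual_visibility_set_iff:
  "total_mutual_visibility_set G X \<longleftrightarrow>
     X \<subseteq> pverts G \<and> (\<forall>x\<in>X. \<forall>y\<in>X. hdist x y \<noteq> 2)"
proof (intro iffI conjI ballI notI)
  assume "total_mutual_visibility_set G X"
  then show sub: "X \<subseteq> pverts G" by (simp add: total_mutual_visibility_set_def)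
  have vis: "visible G X w z" if "w \<in> pverts G" "z \<in> pverts G" for w z
    using that \<open>total_mutual_visibility_set G X\<close> by (simp add: total_mutual_visibility_set_def)
  fix x y assume xy: "x \<in> X" "y \<in> X" "hdist x y = 2"
  obtain a b c a' b' c' where x: "x = ((a, b), c)" and y: "y = ((a', b'), c')"
    by (metis surj_pair)
  have V: "a \<in> A" "b \<in> B" "c \<in> C" "a' \<in> A" "b' \<in> B" "c' \<in> C"
    using xy sub x y by (auto simp: pverts_eq)
  \<comment> \<open>Here \<open>w\<close> and \<open>z\<close> are the other two corners of the
    square with diagonal \<open>x\<close>, \<open>y\<close>. Their only common neighbours are
    \<open>x\<close> and \<open>y\<close>, both in \<open>X\<close>, so every shortest path between
    \<open>w\<close> and \<open>z\<close> is blocked.\<close>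
  have no_square: False
    if "w \<in> pverts G" "z \<in> pverts G" "hdist w z = 2" "hdist w x = 1" "hdist x z = 1"
      and mid: "\<And>m. m \<in> pverts G \<Longrightarrow> hdist w m = 1 \<Longrightarrow> hdist m z = 1 \<Longrightarrow> m = x \<or> m = y" for w z
    using visible_hdist_2_obtains_midpoint[of X w z x] vis that xy sub by (metis subsetD)
  consider "a = a'" "b \<noteq> b'" "c \<noteq> c'" | "a \<noteq> a'" "b = b'" "c \<noteq> c'" | "a \<noteq> a'" "b \<noteq> b'" "c = c'"
    using xy(3) by (auto simp: x y of_bool_def split: if_splits)
  then show False
  proof cases
    case 1
    show False
      by (rule no_square[of "((a, b'), c)" "((a, b), c')"])
        (use 1 V in \<open>auto simp: x y pverts_eq of_bool_def split: if_splits\<close>)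
  next
    case 2
    show False
      by (rule no_square[of "((a', b), c)" "((a, b), c')"])
        (use 2 V in \<open>auto simp: x y pverts_eq of_bool_def split: if_splits\<close>)
  next
    case 3
    show False
      by (rule no_square[of "((a', b), c)" "((a, b'), c)"])
        (use 3 V in \<open>auto simp: x y pverts_eq of_bool_def split: if_splits\<close>)
  qed
next
  assume R: "X \<subseteq> pverts G \<and> (\<forall>x\<in>X. \<forall>y\<in>X. hdist x y \<noteq> 2)"
  then have ne2: "\<not> (u \<in> X \<and> v \<in> X)" if "hdist u v = 2" for u v
    using that by blast
  have "visible G X x y" if xy: "x \<in> pverts G" "y \<in> pverts G" for x y
  proof -
    obtain a b c a' b' c' where x: "x = ((a, b), c)" and y: "y = ((a', b'), c')"
      by (metis surj_pair)
    have V: "a \<in> A" "b \<in> B" "c \<in> C" "a' \<in> A" "b' \<in> B" "c' \<in> C"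
      using xy x y by (auto simp: pverts_eq)
    consider "hdist x y \<le> 1"
      | "a = a'" "b \<noteq> b'" "c \<noteq> c'" | "a \<noteq> a'" "b = b'" "c \<noteq> c'" | "a \<noteq> a'" "b \<noteq> b'" "c = c'"
      | "a \<noteq> a'" "b \<noteq> b'" "c \<noteq> c'"
      by (cases "a = a'"; cases "b = b'"; cases "c = c'") (auto simp: x y)
    then show ?thesis
    proof cases
      case 1
      with xy show ?thesis by (rule visible_of_hdist_le_1)
    next
      case 2
      have "\<not> (((a, b'), c) \<in> X \<and> ((a, b), c') \<in> X)" by (rule ne2) (use 2 in auto)
      then show ?thesis
        using visible_via1[of x y "((a, b'), c)" X] visible_via1[of x y "((a, b), c')" X] 2 V
        by (auto simp: x y pverts_eq)
    next
      case 3
      have "\<not> (((a', b), c) \<in> X \<and> ((a, b), c') \<in> X)" by (rule ne2) (use 3 in auto)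
      then show ?thesis
        using visible_via1[of x y "((a', b), c)" X] visible_via1[of x y "((a, b), c')" X] 3 V
        by (auto simp: x y pverts_eq)
    next
      case 4
      have "\<not> (((a', b), c) \<in> X \<and> ((a, b'), c) \<in> X)" by (rule ne2) (use 4 in auto)
      then show ?thesis
        using visible_via1[of x y "((a', b), c)" X] visible_via1[of x y "((a, b'), c)" X] 4 V
        by (auto simp: x y pverts_eq)
    next
      case 5
      \<comment> \<open>\<open>?u1\<close>, \<open>?u2\<close>, \<open>?u3\<close> are the
        neighbours of \<open>x\<close> in the cube, each taking one coordinate from
        \<open>y\<close>; \<open>?v1\<close>, \<open>?v2\<close>, \<open>?v3\<close> are those of
        \<open>y\<close>, each taking one coordinate from \<open>x\<close>. A \<open>u\<close> and a
        \<open>v\<close> are adjacent iff their indices differ. Within each triple the distances are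
        2, so \<open>X\<close> contains at most one member of each.\<close>
      let ?u1 = "((a', b), c)" and ?u2 = "((a, b'), c)" and ?u3 = "((a, b), c')"
      let ?v1 = "((a, b'), c')" and ?v2 = "((a', b), c')" and ?v3 = "((a', b'), c)"
      have u: "\<not> (?u1 \<in> X \<and> ?u2 \<in> X)" "\<not> (?u1 \<in> X \<and> ?u3 \<in> X)" "\<not> (?u2 \<in> X \<and> ?u3 \<in> X)"
        by (rule ne2; use 5 in simp)+
      have v: "\<not> (?v1 \<in> X \<and> ?v2 \<in> X)" "\<not> (?v1 \<in> X \<and> ?v3 \<in> X)" "\<not> (?v2 \<in> X \<and> ?v3 \<in> X)"
        by (rule ne2; use 5 in simp)+
      have via: "visible G X x y"
        if "p \<notin> X" "q \<notin> X" "p \<in> pverts G" "q \<in> pverts G"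
          "hdist x p = 1" "hdist p q = 1" "hdist q y = 1" for p q
        using visible_via2[of x y p q X] that xy 5 by (simp add: x y)
      \<comment> \<open>\<open>X\<close> misses \<open>?u1\<close> or \<open>?u2\<close>. Whichever
        is missed has two neighbours among the \<open>v\<close>, and \<open>X\<close> misses one of
        these.\<close>
      have "visible G X x y" if "?u1 \<notin> X" "?v2 \<notin> X \<or> ?v3 \<notin> X"
        using via[of ?u1 ?v2] via[of ?u1 ?v3] that 5 V by (auto simp: x y pverts_eq)
      moreover have "visible G X x y" if "?u2 \<notin> X" "?v1 \<notin> X \<or> ?v3 \<notin> X"
        using via[of ?u2 ?v1] via[of ?u2 ?v3] that 5 V by (auto simp: x y pverts_eq)
      ultimately show ?thesis using u v by blast
    qed
  qed
  with R show "total_mutual_visibility_set G X"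
    by (simp add: total_mutual_visibility_set_def)
qed

end

text \<open>In a complete graph any two distinct vertices are adjacent, so an arc of the product is
  precisely a change of one coordinate. \<open>\<box>\<close> associates to the left, whence the
  left-nested triples.\<close>

lemma hamming_graph_complete:
  assumes "complete_digraph n1 (with_proj K1)"
    and "complete_digraph n2 (with_proj K2)"
    and "complete_digraph n3 (with_proj K3)"
  shows "hamming_graph (K1 \<box> K2 \<box> K3) (pverts K1) (pverts K2) (pverts K3)"
proof -
  have "parcs K1 = {(u, v). (u, v) \<in> pverts K1 \<times> pverts K1 \<and> u \<noteq> v}"
    "parcs K2 = {(u, v). (u, v) \<in> pverts K2 \<times> pverts K2 \<and> u \<noteq> v}"
    "parcs K3 = {(u, v). (u, v) \<in> pverts K3 \<times> pverts K3 \<and> u \<noteq> v}"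
    using assms by (simp_all add: complete_digraph_def)
  then show ?thesis
    by unfold_locales (auto simp: cart_prod_def of_bool_def split: if_splits)
qed

section \<open>Upper bound by classes of points at distance at most one\<close>

lemma line_if_hdist_le_1:
  assumes "L \<noteq> {}" and le1: "\<forall>x\<in>L. \<forall>y\<in>L. hdist x y \<le> 1"
  obtains b c where "L \<subseteq> {((a, b), c) | a. True}"
  | a c where "L \<subseteq> {((a, b), c) | b. True}"
  | a b where "L \<subseteq> {((a, b), c) | c. True}"
proof -
  obtain x where x: "x \<in> L" using assms(1) by blast
  obtain a b c where xe: "x = ((a, b), c)" by (metis surj_pair)
  show thesis
  proof (cases "L = {x}")
    case True
    with xe that(1)[of b c] show thesis by simp
  next
    case False
    with x obtain y where y: "y \<in> L" "y \<noteq> x" by blast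
    obtain a' b' c' where ye: "y = ((a', b'), c')" by (metis surj_pair)
    \<comment> \<open>\<open>x\<close> and \<open>y\<close> differ in just one coordinate. A point
      of \<open>L\<close> differing from \<open>x\<close> in another coordinate would agree with
      \<open>x\<close> in this one, hence differ from \<open>y\<close> in both. So all of
      \<open>L\<close> lies on the line through \<open>x\<close> and \<open>y\<close>.\<close>
    have zx: "of_bool (p \<noteq> a) + of_bool (q \<noteq> b) + of_bool (r \<noteq> c) \<le> (1::nat)"
      and zy: "of_bool (p \<noteq> a') + of_bool (q \<noteq> b') + of_bool (r \<noteq> c') \<le> (1::nat)"
      if "((p, q), r) \<in> L" for p q r
      using le1[rule_format, OF that x] le1[rule_format, OF that y(1)] by (simp_all only: xe ye hdist_simps)
    consider "a \<noteq> a'" "b = b'" "c = c'" | "a = a'" "b \<noteq> b'" "c = c'" | "a = a'" "b = b'" "c \<noteq> c'"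
      using zx[OF y(1)[unfolded ye]] y(2) by (auto simp: xe ye of_bool_def split: if_splits)
    then show thesis
    proof cases
      case 1
      have "q = b \<and> r = c" if "((p, q), r) \<in> L" for p q r
        using zx[OF that] zy[OF that] 1 by (auto simp: of_bool_def split: if_splits)
      then show thesis by (intro that(1)[of b c]) fastforce
    next
      case 2
      have "p = a \<and> r = c" if "((p, q), r) \<in> L" for p q r
        using zx[OF that] zy[OF that] 2 by (auto simp: of_bool_def split: if_splits)
      then show thesis by (intro that(2)[of a c]) fastforce
    next
      case 3
      have "p = a \<and> q = b" if "((p, q), r) \<in> L" for p q r
        using zx[OF that] zy[OF that] 3 by (auto simp: of_bool_def split: if_splits)
      then show thesis by (intro that(3)[of a b]) fastforce
    qed
  qed
qed

lemma card_image_const: "L \<noteq> {} \<Longrightarrow> (\<And>x. x \<in> L \<Longrightarrow> f x = k) \<Longrightarrow> card (f ` L) = 1"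
  by (metis card_1_singleton_iff One_nat_def image_cong image_constant_conv)

text \<open>The coordinate along the line is injective on \<open>L\<close> and the other two are
  constant. In each case the three cardinalities add up to \<open>card L + 2\<close>.\<close>

lemma card_projections_line:
  fixes L :: "(('a \<times> 'b) \<times> 'c) set"
  assumes "L \<noteq> {}" and "\<forall>x\<in>L. \<forall>y\<in>L. hdist x y \<le> 1"
  defines "p \<equiv> card ((fst \<circ> fst) ` L)" and "q \<equiv> card ((snd \<circ> fst) ` L)" and "r \<equiv> card (snd ` L)"
  shows "p = card L \<and> q = 1 \<and> r = 1 \<or> p = 1 \<and> q = card L \<and> r = 1 \<or> p = 1 \<and> q = 1 \<and> r = card L"
proof (cases rule: line_if_hdist_le_1[OF assms(1,2)])
  case (1 b c)
  have "p = card L" unfolding p_def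
    by (rule card_image, rule inj_on_subset[OF _ 1]) (auto simp: inj_on_def)
  moreover have "q = 1" unfolding q_def by (rule card_image_const[of _ _ b]) (use 1 assms(1) in force)+
  moreover have "r = 1" unfolding r_def by (rule card_image_const[of _ _ c]) (use 1 assms(1) in force)+
  ultimately show ?thesis by simp
next
  case (2 a c)
  have "q = card L" unfolding q_def
    by (rule card_image, rule inj_on_subset[OF _ 2]) (auto simp: inj_on_def)
  moreover have "p = 1" unfolding p_def by (rule card_image_const[of _ _ a]) (use 2 assms(1) in force)+
  moreover have "r = 1" unfolding r_def by (rule card_image_const[of _ _ c]) (use 2 assms(1) in force)+
  ultimately show ?thesis by simp
next
  case (3 a b)
  have "r = card L" unfolding r_def
    by (rule card_image, rule inj_on_subset[OF _ 3]) (auto simp: inj_on_def)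
  moreover have "p = 1" unfolding p_def by (rule card_image_const[of _ _ a]) (use 3 assms(1) in force)+
  moreover have "q = 1" unfolding q_def by (rule card_image_const[of _ _ b]) (use 3 assms(1) in force)+
  ultimately show ?thesis by simp
qed

text \<open>To be applied with \<open>P\<close> the set of classes and \<open>f\<close> a
  coordinate: the classes compete for the values of that coordinate.\<close>

lemma sum_card_image_le:
  assumes "finite P" "finite V" and "\<And>L. L \<in> P \<Longrightarrow> f ` L \<subseteq> V"
    and "\<And>L M. L \<in> P \<Longrightarrow> M \<in> P \<Longrightarrow> L \<noteq> M \<Longrightarrow> f ` L \<inter> f ` M = {}"
  shows "(\<Sum>L\<in>P. card (f ` L)) \<le> card V"
proof -
  have "(\<Sum>L\<in>P. card (f ` L)) = card (\<Union>L\<in>P. f ` L)"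
    using assms by (intro card_UN_disjoint[symmetric]) (auto intro: finite_subset)
  also have "\<dots> \<le> card V" using assms by (intro card_mono) auto
  finally show ?thesis .
qed

text \<open>The first alternative comes from at most two classes, the second from three or more,
  which occupy at least three values of the last coordinate.\<close>

lemma card_no_hdist_2_le:
  fixes A :: "'a set" and B :: "'b set" and C :: "'c set"
  assumes "finite A" "finite B" "finite C"
    and "card B \<le> card A" "card C \<le> card B" "2 \<le> card C"
    and sub: "X \<subseteq> (A \<times> B) \<times> C" and ne2: "\<And>x y. x \<in> X \<Longrightarrow> y \<in> X \<Longrightarrow> hdist x y \<noteq> 2"
  shows "card X + 2 \<le> card A + card B \<or> 3 \<le> card C \<and> card X + 6 \<le> card A + card B + card C"
proof -
  define r where "r = {(x, y). x \<in> X \<and> y \<in> X \<and> hdist x y \<le> 1}"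
  define P where "P = X // r"
  have finX: "finite X" using sub assms(1-3) by (meson finite_SigmaI finite_subset)
  \<comment> \<open>The triangle inequality leaves distance at most 2, and 2 itself is
    excluded.\<close>
  have trans: "hdist x z \<le> 1" if "x \<in> X" "z \<in> X" "hdist x y \<le> 1" "hdist y z \<le> 1" for x y z
    using hdist_triangle[of x z y] ne2[OF that(1,2)] that by linarith
  have eq: "equiv X r"
  proof (rule equivI)
    show "trans r"
    proof (rule transI)
      fix x y z assume "(x, y) \<in> r" "(y, z) \<in> r"
      then show "(x, z) \<in> r" using trans[of x z y] by (simp add: r_def)
    qed
    show "sym r"
      by (rule symI) (simp add: r_def hdist_commute)
  qed (auto simp: r_def refl_on_def)
  have finP: "finite P" unfolding P_def by (rule finite_quotient[OF finX]) (auto simp: r_def)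
  have subX: "L \<subseteq> X" "L \<noteq> {}" if "L \<in> P" for L
    using that in_quotient_imp_subset[OF eq] in_quotient_imp_non_empty[OF eq] by (auto simp: P_def)
  have within: "\<forall>x\<in>L. \<forall>y\<in>L. hdist x y \<le> 1" if "L \<in> P" for L
    using that in_quotient_imp_in_rel[OF eq, of L] unfolding P_def r_def by blast
  \<comment> \<open>Points of different classes are more than 1 apart and not 2 apart, so they
    differ in all three coordinates. This makes the projections of the classes disjoint.\<close>
  have between: "hdist x y = 3" if "L \<in> P" "M \<in> P" "L \<noteq> M" "x \<in> L" "y \<in> M" for L M x y
  proof -
    have "x \<in> X" "y \<in> X" using that subX by auto
    moreover have "(x, y) \<notin> r"
      using that quotient_eqI[OF eq, of L M x y] by (auto simp: P_def)
    ultimately show ?thesis using hdist_le_3[of x y] ne2[of x y] by (fastforce simp: r_def)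
  qed
  define p q s where "p = (\<lambda>L::(('a \<times> 'b) \<times> 'c) set. card ((fst \<circ> fst) ` L))"
    and "q = (\<lambda>L::(('a \<times> 'b) \<times> 'c) set. card ((snd \<circ> fst) ` L))"
    and "s = (\<lambda>L::(('a \<times> 'b) \<times> 'c) set. card (snd ` L))"
  have line: "p L = card L \<and> q L = 1 \<and> s L = 1 \<or> p L = 1 \<and> q L = card L \<and> s L = 1
      \<or> p L = 1 \<and> q L = 1 \<and> s L = card L" and pos: "card L \<ge> 1" if "L \<in> P" for L
    using card_projections_line[of L] that subX[OF that] within[OF that] finX
    by (auto simp: p_def q_def s_def Suc_le_eq card_gt_0_iff intro: finite_subset)
  have "(\<Sum>L\<in>P. p L) \<le> card A" unfolding p_def
  proof (rule sum_card_image_le[OF finP assms(1)])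
    show "(fst \<circ> fst) ` L \<subseteq> A" if "L \<in> P" for L using subX[OF that] sub by fastforce
    show "(fst \<circ> fst) ` L \<inter> (fst \<circ> fst) ` M = {}" if "L \<in> P" "M \<in> P" "L \<noteq> M" for L M
      using between[OF that] by (fastforce simp: hdist_def of_bool_def split: if_splits)
  qed
  moreover have "(\<Sum>L\<in>P. q L) \<le> card B" unfolding q_def
  proof (rule sum_card_image_le[OF finP assms(2)])
    show "(snd \<circ> fst) ` L \<subseteq> B" if "L \<in> P" for L using subX[OF that] sub by fastforce
    show "(snd \<circ> fst) ` L \<inter> (snd \<circ> fst) ` M = {}" if "L \<in> P" "M \<in> P" "L \<noteq> M" for L M
      using between[OF that] by (fastforce simp: hdist_def of_bool_def split: if_splits)
  qed
  moreover have "(\<Sum>L\<in>P. s L) \<le> card C" unfolding s_def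
  proof (rule sum_card_image_le[OF finP assms(3)])
    show "snd ` L \<subseteq> C" if "L \<in> P" for L using subX[OF that] sub by fastforce
    show "snd ` L \<inter> snd ` M = {}" if "L \<in> P" "M \<in> P" "L \<noteq> M" for L M
      using between[OF that] by (fastforce simp: hdist_def of_bool_def split: if_splits)
  qed
  ultimately have sums: "(\<Sum>L\<in>P. p L) \<le> card A" "(\<Sum>L\<in>P. q L) \<le> card B" "(\<Sum>L\<in>P. s L) \<le> card C"
    by blast+
  have "card (\<Union>P) = (\<Sum>L\<in>P. card L)"
  proof (rule card_Union_disjoint)
    show "pairwise disjnt P"
      using quotient_disj[OF eq] unfolding pairwise_def disjnt_def P_def by blast
    show "finite L" if "L \<in> P" for L using subX[OF that] finX by (blast intro: finite_subset)
  qed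
  then have cardX: "card X = (\<Sum>L\<in>P. card L)"
    using Union_quotient[OF eq] by (simp add: P_def)
  consider "card P = 0" | "card P = 1" | "card P = 2" | "card P \<ge> 3" by linarith
  then show ?thesis
  proof cases
    case 1
    then show ?thesis using cardX finP assms(4-6) by simp
  next
    case 2
    then obtain L where "P = {L}" using card_1_singletonE by blast
    then show ?thesis using cardX sums line[of L] assms(4-6) by auto
  next
    case 3
    then obtain L M where "P = {L, M}" "L \<noteq> M" by (meson card_2_iff)
    then have "p L + p M \<le> card A" "q L + q M \<le> card B" "s L + s M \<le> card C"
      "card X = card L + card M"
      using sums cardX by auto
    moreover have "L \<in> P" "M \<in> P" using \<open>P = {L, M}\<close> by simp_all
    note line[OF this(1)] line[OF this(2)] pos[OF this(1)] pos[OF this(2)]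
    \<comment> \<open>If both classes have the same direction, \<open>card X\<close> is at most one
      side, and the other side contributes at least 2. If the directions differ, each class loses
      one value of its own side to the other class, and two sides sum to at most
      \<open>card A + card B\<close>.\<close>
    ultimately have "card X + 2 \<le> card A + card B"
      using assms(4-6) by (elim disjE conjE) linarith+
    then show ?thesis ..
  next
    case 4
    have "card X + 2 * card P = (\<Sum>L\<in>P. card L + 2)" by (simp only: cardX sum.distrib) simp
    also have "\<dots> = (\<Sum>L\<in>P. p L + q L + s L)" using line by (intro sum.cong) fastforce+
    also have "\<dots> \<le> card A + card B + card C" using sums by (simp add: sum.distrib)
    finally have "card X + 6 \<le> card A + card B + card C" using 4 by linarith
    moreover have "(\<Sum>L\<in>P. 1) \<le> (\<Sum>L\<in>P. s L)" using line pos by (intro sum_mono) fastforce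
    then have "3 \<le> card C" using 4 sums by simp
    ultimately show ?thesis by blast
  qed
qed

section \<open>Extremal sets\<close>

lemma ex_two_lines:
  assumes "finite A" "finite B" "2 \<le> card A" "2 \<le> card B" "2 \<le> card C"
  shows "\<exists>X \<subseteq> (A \<times> B) \<times> C. (\<forall>x\<in>X. \<forall>y\<in>X. hdist x y \<noteq> 2) \<and> card X + 2 = card A + card B"
proof -
  obtain a1 where a: "a1 \<in> A" using assms(3) by fastforce
  obtain b0 where b: "b0 \<in> B" using assms(4) by fastforce
  obtain c0 c1 where c: "c0 \<in> C" "c1 \<in> C" "c0 \<noteq> c1"
    using assms(5) by (meson card_2_iff' obtain_subset_with_card_n subsetD)
  \<comment> \<open>Each line omits the value at which the other is fixed, and \<open>c0\<close>,
    \<open>c1\<close> separate the last coordinates, so points of different lines are at distance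
    3.\<close>
  let ?L = "(\<lambda>a. ((a, b0), c0)) ` (A - {a1})" and ?M = "(\<lambda>b. ((a1, b), c1)) ` (B - {b0})"
  have "card ?L = card A - 1" "card ?M = card B - 1"
    using assms a b by (simp_all add: card_image inj_on_def)
  moreover have "card (?L \<union> ?M) = card ?L + card ?M"
    using assms c by (intro card_Un_disjoint) auto
  ultimately have "card (?L \<union> ?M) + 2 = card A + card B" using assms by linarith
  moreover have "?L \<union> ?M \<subseteq> (A \<times> B) \<times> C" using a b c by auto
  moreover have "\<forall>x\<in>?L \<union> ?M. \<forall>y\<in>?L \<union> ?M. hdist x y \<noteq> 2"
    using c by (auto simp: of_bool_def split: if_splits)
  ultimately show ?thesis by blast
qed

lemma ex_three_lines:
  assumes "finite A" "finite B" "finite C" "3 \<le> card A" "3 \<le> card B" "3 \<le> card C"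
  shows "\<exists>X \<subseteq> (A \<times> B) \<times> C. (\<forall>x\<in>X. \<forall>y\<in>X. hdist x y \<noteq> 2)
    \<and> card X + 6 = card A + card B + card C"
proof -
  have ex2: "\<exists>u\<in>S. \<exists>v\<in>S. u \<noteq> v" if "3 \<le> card S" for S :: "'d set"
    using that by (metis card_2_iff' obtain_subset_with_card_n subsetD Suc_leD eval_nat_numeral(3))
  obtain a1 a2 where a: "a1 \<in> A" "a2 \<in> A" "a1 \<noteq> a2" using ex2[OF assms(4)] by blast
  obtain b0 b2 where b: "b0 \<in> B" "b2 \<in> B" "b0 \<noteq> b2" using ex2[OF assms(5)] by blast
  obtain c0 c1 where c: "c0 \<in> C" "c1 \<in> C" "c0 \<noteq> c1" using ex2[OF assms(6)] by blast
  \<comment> \<open>One line in each direction, omitting the two values at which the other lines are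
    fixed. Again points of different lines differ everywhere, and each line costs two
    values.\<close>
  let ?L = "(\<lambda>a. ((a, b0), c0)) ` (A - {a1, a2})" and ?M = "(\<lambda>b. ((a1, b), c1)) ` (B - {b0, b2})"
    and ?N = "(\<lambda>c. ((a2, b2), c)) ` (C - {c0, c1})"
  have "card ?L = card A - 2" "card ?M = card B - 2" "card ?N = card C - 2"
    using assms a b c by (simp_all add: card_image inj_on_def card_Diff_subset)
  moreover have "card (?L \<union> ?M \<union> ?N) = card (?L \<union> ?M) + card ?N"
    using assms a b c by (intro card_Un_disjoint) auto
  moreover have "card (?L \<union> ?M) = card ?L + card ?M"
    using assms c by (intro card_Un_disjoint) auto
  ultimately have "card (?L \<union> ?M \<union> ?N) + 6 = card A + card B + card C" using assms by linarith
  moreover have "?L \<union> ?M \<union> ?N \<subseteq> (A \<times> B) \<times> C" using a b c by auto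
  moreover have "\<forall>x\<in>?L \<union> ?M \<union> ?N. \<forall>y\<in>?L \<union> ?M \<union> ?N. hdist x y \<noteq> 2"
    using a b c by (auto simp: of_bool_def split: if_splits)
  ultimately show ?thesis by blast
qed

section \<open>The value of the total mutual-visibility number\<close>

theorem theorem1p1:
  fixes K1 :: "'a pair_pre_digraph" and K2 :: "'b pair_pre_digraph" and K3 :: "'c pair_pre_digraph"
    and n1 n2 n3 N :: nat
  assumes "n1 \<ge> n2" and "n2 \<ge> n3" and "n3 \<ge> 2"
    and "N = n1 + n2 + n3"
    and "complete_digraph n1 (with_proj K1)"
    and "complete_digraph n2 (with_proj K2)"
    and "complete_digraph n3 (with_proj K3)"
  shows "\<mu>\<^sub>t (K1 \<box> K2 \<box> K3) =
    (if n3 = 2 then N - 4 else if n3 = 3 then N - 5 else N - 6)"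
proof -
  let ?A = "pverts K1" and ?B = "pverts K2" and ?C = "pverts K3"
  let ?m = "if n3 = 2 then N - 4 else if n3 = 3 then N - 5 else N - 6"
  interpret hamming_graph "K1 \<box> K2 \<box> K3" ?A ?B ?C
    by (rule hamming_graph_complete[OF assms(5-7)])
  have card: "card ?A = n1" "card ?B = n2" "card ?C = n3"
    using assms(5-7) by (simp_all add: complete_digraph_def)
  \<comment> \<open>\<open>card\<close> is 0 on infinite sets, so positive cardinality gives
    finiteness.\<close>
  have fin: "finite ?A" "finite ?B" "finite ?C"
    using card assms(1-3) by (auto intro: card_ge_0_finite)
  let ?S = "{card X | X. total_mutual_visibility_set (K1 \<box> K2 \<box> K3) X}"
  have le: "k \<le> ?m" if "k \<in> ?S" for k
  proof -
    obtain X where X: "k = card X" "X \<subseteq> (?A \<times> ?B) \<times> ?C" "\<And>x y. x \<in> X \<Longrightarrow> y \<in> X \<Longrightarrow> hdist x y \<noteq> 2"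
      using \<open>k \<in> ?S\<close> unfolding total_mutual_visibility_set_iff pverts_eq by blast
    have "k + 2 \<le> n1 + n2 \<or> 3 \<le> n3 \<and> k + 6 \<le> n1 + n2 + n3"
      using card_no_hdist_2_le[OF fin _ _ _ X(2,3)] card assms(1-3) X(1) by simp
    then show ?thesis using assms(1-4) by auto
  qed
  have "?m \<in> ?S"
  proof -
    have "\<exists>X \<subseteq> (?A \<times> ?B) \<times> ?C. (\<forall>x\<in>X. \<forall>y\<in>X. hdist x y \<noteq> 2) \<and> card X = ?m"
    \<comment> \<open>Two lines give \<open>N - (n3 + 2)\<close> points and three give
      \<open>N - 6\<close>. The former is larger for \<open>n3\<close> equal to 2 or 3; the two
      agree at 4, and beyond that three lines are better.\<close>
    proof (cases "n3 \<le> 3")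
      case True
      obtain X where "X \<subseteq> (?A \<times> ?B) \<times> ?C" "\<forall>x\<in>X. \<forall>y\<in>X. hdist x y \<noteq> 2" "card X + 2 = n1 + n2"
        using ex_two_lines[of ?A ?B ?C] fin card assms(1-3) by auto
      moreover from this(3) have "card X = ?m" using True assms(3,4) by auto
      ultimately show ?thesis by blast
    next
      case False
      obtain X where "X \<subseteq> (?A \<times> ?B) \<times> ?C" "\<forall>x\<in>X. \<forall>y\<in>X. hdist x y \<noteq> 2"
        "card X + 6 = n1 + n2 + n3"
        using ex_three_lines[of ?A ?B ?C] fin card assms(1-3) False by auto
      moreover from this(3) have "card X = ?m" using False assms(4) by auto
      ultimately show ?thesis by blast
    qed
    then show ?thesis
      unfolding total_mutual_visibility_set_iff pverts_eq mem_Collect_eq by metis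
  qed
  moreover have "finite ?S" using le by (meson finite_nat_set_iff_bounded_le)
  ultimately show ?thesis unfolding mu_t_def using le by (intro Max_eqI) auto
qed

end
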